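(* Let $R$ be an $\mathbb{N}$-graded Noetherian ring and let $I\subseteq R$ be a homogeneous ideal such that the symbolic Rees algebra $R_s(I)$ is generated in degree at most $n$. Then $$\hat{\alpha}(I)=\min_{m\leq n}\frac{\alpha(I^{(m)})}{m},$$ where $m$ ranges over the positive integers at most $n$.
   Context: For an ideal $I$ of a commutative Noetherian ring $R$, the $m$-th symbolic power is $I^{(m)}=\bigcap_{\mathfrak p\in \mathrm{Ass}(I)}(I^m R_{\mathfrak p}\cap R)$, where $\mathrm{Ass}(I)$ is the set of associated primes of $I$ (that is, of $R/I$). The symbolic Rees algebra is $R_s(I)=\bigoplus_{i\ge 0} I^{(i)}t^i\subseteq R[t]$, graded by the power of the indeterminate $t$; it is generated in degree at most $n$ if it is generated as an $R$-algebra by homogeneous elements of $t$-degree at most $n$, i.e. $R_s(I)=R[It,I^{(2)}t^2,\ldots,I^{(n)}t^n]$. For an ideal $J$ of an $\mathbb{N}$-graded ring, $\alpha(J)=\min\{\deg f \mid f\in J,\ f\neq 0\}$. The Waldschmidt constant is $\hat{\alpha}(I)=\lim_{m\to\infty}\frac{\alpha(I^{(m)})}{m}$.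
   Formalization: R is additionally assumed reduced; without this the claim fails, e.g. R = k[x,y]/(x²), deg x = 1, deg y = 5, I = (x,y), n = 1, where α(I^(m)) = 5m − 4, so the Waldschmidt constant is 5 but the minimum is 1. *)

theory Defs
  imports
    "HOL-Library.Extended_Real"
    "HOL-Algebra.Algebra"
begin

section \<open>Reduced rings and rings of fractions\<close>

text \<open>Reducedness gives \<open>\<alpha>(I\<^sup>(\<^sup>k\<^sup>m\<^sup>)) \<le> k \<alpha>(I\<^sup>(\<^sup>m\<^sup>))\<close>, which fails in general: for \<open>R = k[x, y]/(x\<^sup>2)\<close> with
  \<open>deg x = 1\<close>, \<open>deg y = 5\<close> and \<open>I = (x, y)\<close> one has \<open>I\<^sup>(\<^sup>m\<^sup>) = I\<^sup>m\<close> and \<open>\<alpha>(I\<^sup>m) = 5 m - 4\<close>, so the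
  Waldschmidt constant is \<open>5\<close> although \<open>\<alpha>(I) = 1\<close> and \<open>R\<^sub>s(I) = R[I t]\<close>.\<close>

definition reduced_ring :: "('a, 'b) ring_scheme \<Rightarrow> bool" where
  "reduced_ring R \<longleftrightarrow>
     (\<forall>x\<in>carrier R. \<forall>k::nat. x [^]\<^bsub>R\<^esub> k = \<zero>\<^bsub>R\<^esub> \<longrightarrow> x = \<zero>\<^bsub>R\<^esub>)"

text \<open>The pairs \<open>(a, s)\<close> and \<open>(b, t)\<close> represent the same fraction of \<open>S\<inverse>R\<close> iff
  \<open>u (a t - b s) = 0\<close> for some \<open>u \<in> S\<close>; the factor \<open>u\<close> is needed since \<open>R\<close> may have zero divisors.\<close>

definition frac_rel :: "('a, 'b) ring_scheme \<Rightarrow> 'a set \<Rightarrow> (('a \<times> 'a) \<times> ('a \<times> 'a)) set" where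
  "frac_rel R S = {((a, s), (b, t)) | a s b t.
     a \<in> carrier R \<and> s \<in> S \<and> b \<in> carrier R \<and> t \<in> S \<and>
     (\<exists>u\<in>S. u \<otimes>\<^bsub>R\<^esub> ((a \<otimes>\<^bsub>R\<^esub> t) \<ominus>\<^bsub>R\<^esub> (b \<otimes>\<^bsub>R\<^esub> s)) = \<zero>\<^bsub>R\<^esub>)}"

definition fraction :: "('a, 'b) ring_scheme \<Rightarrow> 'a set \<Rightarrow> 'a \<Rightarrow> 'a \<Rightarrow> ('a \<times> 'a) set" where
  "fraction R S a s = frac_rel R S `` {(a, s)}"

definition localization :: "('a, 'b) ring_scheme \<Rightarrow> 'a set \<Rightarrow> (('a \<times> 'a) set) ring" where
  "localization R S =
    \<lparr>carrier = (carrier R \<times> S) // frac_rel R S,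
     monoid.mult = (\<lambda>U V. \<Union>(a, s)\<in>U. \<Union>(b, t)\<in>V. fraction R S (a \<otimes>\<^bsub>R\<^esub> b) (s \<otimes>\<^bsub>R\<^esub> t)),
     monoid.one = fraction R S \<one>\<^bsub>R\<^esub> \<one>\<^bsub>R\<^esub>,
     ring.zero = fraction R S \<zero>\<^bsub>R\<^esub> \<one>\<^bsub>R\<^esub>,
     ring.add = (\<lambda>U V. \<Union>(a, s)\<in>U. \<Union>(b, t)\<in>V.
                   fraction R S ((a \<otimes>\<^bsub>R\<^esub> t) \<oplus>\<^bsub>R\<^esub> (b \<otimes>\<^bsub>R\<^esub> s)) (s \<otimes>\<^bsub>R\<^esub> t))\<rparr>"

definition local_ring_at :: "('a, 'b) ring_scheme \<Rightarrow> 'a set \<Rightarrow> (('a \<times> 'a) set) ring" where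
  "local_ring_at R P = localization R (carrier R - P)"

definition to_local_ring :: "('a, 'b) ring_scheme \<Rightarrow> 'a set \<Rightarrow> 'a \<Rightarrow> ('a \<times> 'a) set" where
  "to_local_ring R P a = fraction R (carrier R - P) a \<one>\<^bsub>R\<^esub>"

text \<open>\<open>J R\<^sub>P \<inter> R\<close>: the preimage under \<open>R \<rightarrow> R\<^sub>P\<close> of the ideal of \<open>R\<^sub>P\<close> generated by the image of \<open>J\<close>.\<close>

definition local_contraction :: "('a, 'b) ring_scheme \<Rightarrow> 'a set \<Rightarrow> 'a set \<Rightarrow> 'a set" where
  "local_contraction R P J =
     {r \<in> carrier R.
        to_local_ring R P r \<in> genideal (local_ring_at R P) (to_local_ring R P ` J)}"

section \<open>Symbolic powers and the symbolic Rees algebra\<close>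

text \<open>The associated primes of the \<open>R\<close>-module \<open>R/I\<close>, i.e. the prime ideals that are the annihilator
  of some \<open>\<xi> \<in> R/I\<close>; a scalar \<open>r\<close> acts as multiplication by its residue class.\<close>

definition associated_primes :: "('a, 'b) ring_scheme \<Rightarrow> 'a set \<Rightarrow> 'a set set" where
  "associated_primes R I =
     {P. primeideal P R \<and>
         (\<exists>\<xi>\<in>carrier (R Quot I).
            P = {r \<in> carrier R. (I +>\<^bsub>R\<^esub> r) \<otimes>\<^bsub>R Quot I\<^esub> \<xi> = \<zero>\<^bsub>R Quot I\<^esub>})}"

text \<open>The intersection is taken inside \<open>R\<close>; in particular it is \<open>R\<close> when \<open>I = R\<close>.\<close>

definition symbolic_power :: "('a, 'b) ring_scheme \<Rightarrow> 'a set \<Rightarrow> nat \<Rightarrow> 'a set" where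
  "symbolic_power R I m =
     carrier R \<inter>
       (\<Inter>P\<in>associated_primes R I. local_contraction R P (I [^]\<^bsub>ideals_set R\<^esub> m))"

definition symbolic_Rees_algebra :: "('a, 'b) ring_scheme \<Rightarrow> 'a set \<Rightarrow> (nat \<Rightarrow> 'a) set" where
  "symbolic_Rees_algebra R I =
     {f \<in> carrier (UP R). \<forall>i. coeff (UP R) f i \<in> symbolic_power R I i}"

text \<open>\<open>R\<^sub>s(I) = R[I t, I\<^sup>(\<^sup>2\<^sup>) t\<^sup>2, \<dots>, I\<^sup>(\<^sup>n\<^sup>) t\<^sup>n]\<close>; the constants are adjoined so that the subring generated
  is an \<open>R\<close>-subalgebra.\<close>

definition symbolic_Rees_generated_upto ::
    "('a, 'b) ring_scheme \<Rightarrow> 'a set \<Rightarrow> nat \<Rightarrow> bool" where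
  "symbolic_Rees_generated_upto R I n \<longleftrightarrow>
     symbolic_Rees_algebra R I =
       generate_ring (UP R)
         ({monom (UP R) a 0 | a. a \<in> carrier R} \<union>
          {monom (UP R) a i | a i. 1 \<le> i \<and> i \<le> n \<and> a \<in> symbolic_power R I i})"

section \<open>Graded rings and the Waldschmidt constant\<close>

text \<open>\<open>A i\<close> is the degree \<open>i\<close> piece: \<open>R\<close> is the internal direct sum of the \<open>A i\<close>.\<close>

definition is_decomposition ::
    "('a, 'b) ring_scheme \<Rightarrow> (nat \<Rightarrow> 'a set) \<Rightarrow> 'a \<Rightarrow> (nat \<Rightarrow> 'a) \<Rightarrow> bool" where
  "is_decomposition R A r c \<longleftrightarrow>
     (\<forall>i. c i \<in> A i) \<and> finite {i. c i \<noteq> \<zero>\<^bsub>R\<^esub>} \<and>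
     r = (\<Oplus>\<^bsub>R\<^esub>i\<in>{i. c i \<noteq> \<zero>\<^bsub>R\<^esub>}. c i)"

locale graded_cring = cring R for R (structure) +
  fixes A :: "nat \<Rightarrow> 'a set"
  assumes piece_subgroup: "additive_subgroup (A i) R"
    and piece_mult: "\<lbrakk>a \<in> A i; b \<in> A j\<rbrakk> \<Longrightarrow> a \<otimes> b \<in> A (i + j)"
    and decomposition: "r \<in> carrier R \<Longrightarrow> \<exists>!c. is_decomposition R A r c"

definition component ::
    "('a, 'b) ring_scheme \<Rightarrow> (nat \<Rightarrow> 'a set) \<Rightarrow> 'a \<Rightarrow> nat \<Rightarrow> 'a" where
  "component R A r = (THE c. is_decomposition R A r c)"

definition homogeneous_ideal ::
    "('a, 'b) ring_scheme \<Rightarrow> (nat \<Rightarrow> 'a set) \<Rightarrow> 'a set \<Rightarrow> bool" where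
  "homogeneous_ideal R A I \<longleftrightarrow>
     ideal I R \<and> (\<exists>H \<subseteq> (\<Union>i. A i). I = genideal R H)"

text \<open>The degree of a nonzero, not necessarily homogeneous, element is its largest degree.\<close>

definition graded_degree ::
    "('a, 'b) ring_scheme \<Rightarrow> (nat \<Rightarrow> 'a set) \<Rightarrow> 'a \<Rightarrow> nat" where
  "graded_degree R A f = Max {i. component R A f i \<noteq> \<zero>\<^bsub>R\<^esub>}"

text \<open>The infimum in \<^typ>\<open>enat\<close> is a minimum if \<open>J\<close> is nonzero, and \<open>\<infinity>\<close> for the zero ideal.\<close>

definition initial_degree ::
    "('a, 'b) ring_scheme \<Rightarrow> (nat \<Rightarrow> 'a set) \<Rightarrow> 'a set \<Rightarrow> enat" where
  "initial_degree R A J = (INF f \<in> J - {\<zero>\<^bsub>R\<^esub>}. enat (graded_degree R A f))"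

definition waldschmidt_quotient ::
    "('a, 'b) ring_scheme \<Rightarrow> (nat \<Rightarrow> 'a set) \<Rightarrow> 'a set \<Rightarrow> nat \<Rightarrow> ereal" where
  "waldschmidt_quotient R A I m =
     ereal_of_enat (initial_degree R A (symbolic_power R I m)) / ereal (real m)"

definition waldschmidt_constant ::
    "('a, 'b) ring_scheme \<Rightarrow> (nat \<Rightarrow> 'a set) \<Rightarrow> 'a set \<Rightarrow> ereal" where
  "waldschmidt_constant R A I = lim (waldschmidt_quotient R A I)"

end

theory Submission
  imports Defs
begin

text \<open>Write \<open>w(m) = \<alpha>(I\<^sup>(\<^sup>m\<^sup>)) / m\<close> and let \<open>\<mu>\<close> be the least of \<open>w(1), \<dots>, w(n)\<close>. The sequence \<open>w\<close> converges to \<open>\<mu>\<close>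
  because \<open>\<mu> \<le> w(m)\<close> for all \<open>m \<ge> 1\<close> and because \<open>w\<close> is eventually not much larger than \<open>\<mu>\<close>.

  For the lower bound, call an element \<open>r\<close> at height \<open>i\<close> steep if all its nonzero homogeneous
  components have degree at least \<open>\<mu> i\<close>. The polynomials whose coefficient at each \<open>t\<^sup>i\<close> is steep at
  height \<open>i\<close> form a subring of \<open>R[t]\<close>, since degrees and heights both add up in products. The
  generators of \<open>R\<^sub>s(I)\<close> of \<open>t\<close>-degree at most \<open>n\<close> lie in that subring by the choice of \<open>\<mu>\<close>, so all of
  \<open>R\<^sub>s(I)\<close> does, in particular \<open>f t\<^sup>m\<close> for every \<open>f \<in> I\<^sup>(\<^sup>m\<^sup>)\<close> (\<open>waldschmidt_quotient_lower\<close>).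

  For the upper bound, take \<open>k\<close> with \<open>w(k) = \<mu>\<close> and a homogeneous nonzero \<open>f \<in> I\<^sup>(\<^sup>k\<^sup>)\<close> of least
  degree \<open>d\<close>. With \<open>q = m div k\<close>, the power \<open>f\<^sup>q\<^sup>+\<^sup>1\<close> is nonzero as \<open>R\<close> is reduced, it lies in
  \<open>I\<^sup>(\<^sup>k\<^sup>(\<^sup>q\<^sup>+\<^sup>1\<^sup>)\<^sup>) \<subseteq> I\<^sup>(\<^sup>m\<^sup>)\<close>, and its degree gives \<open>w(m) \<le> d / k + d / m\<close> (\<open>waldschmidt_quotient_upper\<close>).
  If \<open>\<mu> = \<infinity>\<close>, there is no such \<open>f\<close>, and the lower bound alone gives \<open>w(m) = \<infinity>\<close> for all \<open>m \<ge> 1\<close>.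

  Both halves compare \<open>\<alpha>\<close>, which is defined through the top degree of arbitrary elements, with
  degrees of homogeneous components. This rests on the fact that symbolic powers of a
  homogeneous ideal are homogeneous, which is the main algebraic point (\<open>contraction_component\<close>):
  the contraction of a homogeneous ideal from the local ring at any prime is homogeneous.
  Rings of fractions enter only through the description of that contraction as the set of all \<open>r\<close>
  with \<open>s r \<in> J\<close> for some \<open>s \<notin> P\<close> (\<open>mem_local_contraction_iff\<close>).\<close>

section \<open>Rings of fractions and contracted ideals\<close>

locale cring_submonoid = cring R + S: submonoid S R
  for R (structure) and S
begin

lemma S_carrier: "s \<in> S \<Longrightarrow> s \<in> carrier R"
  using S.subset by blast

lemma S_mult [simp]: "s \<in> S \<Longrightarrow> t \<in> S \<Longrightarrow> s \<otimes> t \<in> S"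
  by (rule S.m_closed)

lemma S_one [simp]: "\<one> \<in> S"
  by (rule S.one_closed)

lemma frac_rel_iff:
  "((a, s), (b, t)) \<in> frac_rel R S \<longleftrightarrow>
     a \<in> carrier R \<and> s \<in> S \<and> b \<in> carrier R \<and> t \<in> S \<and>
     (\<exists>u\<in>S. u \<otimes> (a \<otimes> t) = u \<otimes> (b \<otimes> s))"
proof -
  have "u \<otimes> (a \<otimes> t \<ominus> b \<otimes> s) = \<zero> \<longleftrightarrow> u \<otimes> (a \<otimes> t) = u \<otimes> (b \<otimes> s)"
    if "a \<in> carrier R" "s \<in> S" "b \<in> carrier R" "t \<in> S" "u \<in> S" for u
  proof -
    note c = that(1,3) that(2,4,5)[THEN S_carrier]
    have "u \<otimes> (a \<otimes> t \<ominus> b \<otimes> s) = u \<otimes> (a \<otimes> t) \<ominus> u \<otimes> (b \<otimes> s)"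
      using c by (simp add: a_minus_def r_distr r_minus)
    then show ?thesis
      using c by (simp only: r_right_minus_eq m_closed)
  qed
  then show ?thesis
    by (simp add: frac_rel_def cong: conj_cong bex_cong)
qed

lemma equiv_frac_rel: "equiv (carrier R \<times> S) (frac_rel R S)"
proof (rule equivI)
  show "frac_rel R S \<subseteq> (carrier R \<times> S) \<times> carrier R \<times> S"
    unfolding frac_rel_def by blast
  show "refl_on (carrier R \<times> S) (frac_rel R S)"
    unfolding refl_on_def using S_one by (auto simp: frac_rel_iff)
  show "sym (frac_rel R S)"
  proof (rule symI, clarify)
    fix a s b t assume "((a, s), (b, t)) \<in> frac_rel R S"
    then show "((b, t), (a, s)) \<in> frac_rel R S"
      unfolding frac_rel_iff by metis
  qed
  show "trans (frac_rel R S)"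
  proof (rule transI, clarify)
    fix a s b t c q
    assume "((a, s), (b, t)) \<in> frac_rel R S" "((b, t), (c, q)) \<in> frac_rel R S"
    then obtain u v where
      ab: "a \<in> carrier R" "s \<in> S" "b \<in> carrier R" "t \<in> S" "u \<in> S"
          "u \<otimes> (a \<otimes> t) = u \<otimes> (b \<otimes> s)" and
      bc: "c \<in> carrier R" "q \<in> S" "v \<in> S" "v \<otimes> (b \<otimes> q) = v \<otimes> (c \<otimes> t)"
      unfolding frac_rel_iff by blast
    note carr = ab(1,3) bc(1) ab(2,4,5)[THEN S_carrier] bc(2,3)[THEN S_carrier]
    \<comment> \<open>\<open>t\<close> can be a zero divisor, so it is kept as a factor of the witness instead of being cancelled.\<close>
    have "(u \<otimes> v \<otimes> t) \<otimes> (a \<otimes> q) = (v \<otimes> q) \<otimes> (u \<otimes> (a \<otimes> t))"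
      using carr by (simp add: m_ac)
    also have "\<dots> = (u \<otimes> s) \<otimes> (v \<otimes> (b \<otimes> q))"
      unfolding ab(6) using carr by (simp add: m_ac)
    also have "\<dots> = (u \<otimes> v \<otimes> t) \<otimes> (c \<otimes> s)"
      unfolding bc(4) using carr by (simp add: m_ac)
    finally have "(u \<otimes> v \<otimes> t) \<otimes> (a \<otimes> q) = (u \<otimes> v \<otimes> t) \<otimes> (c \<otimes> s)" .
    moreover have "u \<otimes> v \<otimes> t \<in> S"
      using ab bc by simp
    ultimately show "((a, s), (c, q)) \<in> frac_rel R S"
      using ab(1,2) bc(1,2) unfolding frac_rel_iff by blast
  qed
qed

lemma fraction_eq_iff:
  assumes "a \<in> carrier R" "s \<in> S" "b \<in> carrier R" "t \<in> S"
  shows "fraction R S a s = fraction R S b t \<longleftrightarrow> (\<exists>u\<in>S. u \<otimes> (a \<otimes> t) = u \<otimes> (b \<otimes> s))"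
proof -
  have "fraction R S a s = fraction R S b t \<longleftrightarrow> ((a, s), (b, t)) \<in> frac_rel R S"
    unfolding fraction_def using assms by (intro eq_equiv_class_iff[OF equiv_frac_rel]) simp_all
  then show ?thesis
    using assms by (simp add: frac_rel_iff)
qed

lemma fraction_eqI:
  assumes "a \<in> carrier R" "s \<in> S" "b \<in> carrier R" "t \<in> S" "a \<otimes> t = b \<otimes> s"
  shows "fraction R S a s = fraction R S b t"
  unfolding fraction_eq_iff[OF assms(1-4)] assms(5) using S_one by blast

lemma fraction_self: "a \<in> carrier R \<Longrightarrow> s \<in> S \<Longrightarrow> (a, s) \<in> fraction R S a s"
  unfolding fraction_def by (rule equiv_class_self[OF equiv_frac_rel]) simp

lemma in_fractionD:
  assumes "(b, t) \<in> fraction R S a s"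
  shows "a \<in> carrier R" "s \<in> S" "b \<in> carrier R" "t \<in> S"
    "\<exists>u\<in>S. u \<otimes> (a \<otimes> t) = u \<otimes> (b \<otimes> s)"
  using assms unfolding fraction_def Image_singleton_iff frac_rel_iff by blast+

lemma carrier_localization:
  "carrier (localization R S) = {fraction R S a s | a s. a \<in> carrier R \<and> s \<in> S}"
  unfolding localization_def fraction_def quotient_def by auto

lemma fraction_closed [simp]:
  "a \<in> carrier R \<Longrightarrow> s \<in> S \<Longrightarrow> fraction R S a s \<in> carrier (localization R S)"
  by (auto simp: carrier_localization)

text \<open>Sums and products of fractions are defined as unions over all representatives; such a union
  collapses to a single class once its terms do not depend on the representatives.\<close>

lemma UN_fractions:
  assumes "a \<in> carrier R" "s \<in> S" "b \<in> carrier R" "t \<in> S"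
    and eq: "\<And>a' s' b' t'. (a', s') \<in> fraction R S a s \<Longrightarrow> (b', t') \<in> fraction R S b t \<Longrightarrow>
      f a' s' b' t' = C"
  shows "(\<Union>(a', s')\<in>fraction R S a s. \<Union>(b', t')\<in>fraction R S b t. f a' s' b' t') = C"
proof (rule UN_constant_eq[OF fraction_self[OF assms(1,2)]], rule ballI, split prod.split, intro allI impI)
  fix p a' s' assume "p \<in> fraction R S a s" "p = (a', s')"
  then have a': "(a', s') \<in> fraction R S a s" by simp
  show "(\<Union>(b', t')\<in>fraction R S b t. f a' s' b' t') = C"
  proof (rule UN_constant_eq[OF fraction_self[OF assms(3,4)]], rule ballI, split prod.split, intro allI impI)
    fix q b' t' assume "q \<in> fraction R S b t" "q = (b', t')"
    then show "f a' s' b' t' = C" using eq[OF a'] by simp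
  qed
qed

lemma mult_fraction:
  assumes "a \<in> carrier R" "s \<in> S" "b \<in> carrier R" "t \<in> S"
  shows "fraction R S a s \<otimes>\<^bsub>localization R S\<^esub> fraction R S b t = fraction R S (a \<otimes> b) (s \<otimes> t)"
proof -
  have "fraction R S (a' \<otimes> b') (s' \<otimes> t') = fraction R S (a \<otimes> b) (s \<otimes> t)"
    if a': "(a', s') \<in> fraction R S a s" and b': "(b', t') \<in> fraction R S b t" for a' s' b' t'
  proof -
    note S = in_fractionD(4)[OF a'] in_fractionD(4)[OF b'] assms(2,4)
    obtain u v where u: "u \<in> S" "u \<otimes> (a \<otimes> s') = u \<otimes> (a' \<otimes> s)"
      and v: "v \<in> S" "v \<otimes> (b \<otimes> t') = v \<otimes> (b' \<otimes> t)"
      using in_fractionD(5)[OF a'] in_fractionD(5)[OF b'] by blast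
    note c = in_fractionD(3)[OF a'] in_fractionD(3)[OF b'] assms(1,3)
      S[THEN S_carrier] u(1)[THEN S_carrier] v(1)[THEN S_carrier]
    have "(u \<otimes> v) \<otimes> (a' \<otimes> b' \<otimes> (s \<otimes> t)) = (u \<otimes> (a' \<otimes> s)) \<otimes> (v \<otimes> (b' \<otimes> t))"
      using c by (simp add: m_ac)
    also have "\<dots> = (u \<otimes> v) \<otimes> (a \<otimes> b \<otimes> (s' \<otimes> t'))"
      unfolding u(2)[symmetric] v(2)[symmetric] using c by (simp add: m_ac)
    finally show ?thesis
      using c S by (subst fraction_eq_iff) (auto intro!: bexI[of _ "u \<otimes> v"] simp: u(1) v(1))
  qed
  then show ?thesis
    unfolding localization_def monoid.simps ring.simps by (rule UN_fractions[OF assms])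
qed

lemma add_fraction:
  assumes "a \<in> carrier R" "s \<in> S" "b \<in> carrier R" "t \<in> S"
  shows "fraction R S a s \<oplus>\<^bsub>localization R S\<^esub> fraction R S b t =
    fraction R S (a \<otimes> t \<oplus> b \<otimes> s) (s \<otimes> t)"
proof -
  have "fraction R S (a' \<otimes> t' \<oplus> b' \<otimes> s') (s' \<otimes> t') = fraction R S (a \<otimes> t \<oplus> b \<otimes> s) (s \<otimes> t)"
    if a': "(a', s') \<in> fraction R S a s" and b': "(b', t') \<in> fraction R S b t" for a' s' b' t'
  proof -
    note S = in_fractionD(4)[OF a'] in_fractionD(4)[OF b'] assms(2,4)
    obtain u v where u: "u \<in> S" "u \<otimes> (a \<otimes> s') = u \<otimes> (a' \<otimes> s)"
      and v: "v \<in> S" "v \<otimes> (b \<otimes> t') = v \<otimes> (b' \<otimes> t)"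
      using in_fractionD(5)[OF a'] in_fractionD(5)[OF b'] by blast
    note c = in_fractionD(3)[OF a'] in_fractionD(3)[OF b'] assms(1,3)
      S[THEN S_carrier] u(1)[THEN S_carrier] v(1)[THEN S_carrier]
    have "(u \<otimes> v) \<otimes> ((a' \<otimes> t' \<oplus> b' \<otimes> s') \<otimes> (s \<otimes> t)) =
        (v \<otimes> t' \<otimes> t) \<otimes> (u \<otimes> (a' \<otimes> s)) \<oplus> (u \<otimes> s' \<otimes> s) \<otimes> (v \<otimes> (b' \<otimes> t))"
      using c by (simp add: m_ac l_distr r_distr)
    also have "\<dots> = (u \<otimes> v) \<otimes> ((a \<otimes> t \<oplus> b \<otimes> s) \<otimes> (s' \<otimes> t'))"
      unfolding u(2)[symmetric] v(2)[symmetric] using c by (simp add: m_ac l_distr r_distr)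
    finally show ?thesis
      using c S by (subst fraction_eq_iff) (auto intro!: bexI[of _ "u \<otimes> v"] simp: u(1) v(1))
  qed
  then show ?thesis
    unfolding localization_def monoid.simps ring.simps by (rule UN_fractions[OF assms])
qed

lemma zero_localization: "\<zero>\<^bsub>localization R S\<^esub> = fraction R S \<zero> \<one>"
  and one_localization: "\<one>\<^bsub>localization R S\<^esub> = fraction R S \<one> \<one>"
  by (simp_all add: localization_def)

lemma localization_cases:
  assumes "x \<in> carrier (localization R S)"
  obtains a s where "x = fraction R S a s" "a \<in> carrier R" "s \<in> S" "s \<in> carrier R"
  using assms S_carrier by (auto simp: carrier_localization)

lemma cring_localization: "cring (localization R S)"
proof (rule cringI)
  show "abelian_group (localization R S)"
  proof (rule abelian_groupI)
    fix x y z
    assume x: "x \<in> carrier (localization R S)" and y: "y \<in> carrier (localization R S)"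
      and z: "z \<in> carrier (localization R S)"
    obtain a s where a: "x = fraction R S a s" "a \<in> carrier R" "s \<in> S" "s \<in> carrier R"
      using x by (rule localization_cases)
    obtain b t where b: "y = fraction R S b t" "b \<in> carrier R" "t \<in> S" "t \<in> carrier R"
      using y by (rule localization_cases)
    obtain c q where c: "z = fraction R S c q" "c \<in> carrier R" "q \<in> S" "q \<in> carrier R"
      using z by (rule localization_cases)
    show "x \<oplus>\<^bsub>localization R S\<^esub> y \<in> carrier (localization R S)"
      using a b by (simp add: add_fraction)
    show "x \<oplus>\<^bsub>localization R S\<^esub> y = y \<oplus>\<^bsub>localization R S\<^esub> x"
      using a b by (simp add: add_fraction m_comm a_comm)
    have "(a \<otimes> t \<oplus> b \<otimes> s) \<otimes> q \<oplus> c \<otimes> (s \<otimes> t) = a \<otimes> (t \<otimes> q) \<oplus> (b \<otimes> q \<oplus> c \<otimes> t) \<otimes> s"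
      using a b c by (simp add: m_ac a_ac l_distr r_distr)
    then show "(x \<oplus>\<^bsub>localization R S\<^esub> y) \<oplus>\<^bsub>localization R S\<^esub> z =
        x \<oplus>\<^bsub>localization R S\<^esub> (y \<oplus>\<^bsub>localization R S\<^esub> z)"
      using a b c by (simp add: add_fraction m_assoc)
    show "\<zero>\<^bsub>localization R S\<^esub> \<oplus>\<^bsub>localization R S\<^esub> x = x"
      using a by (simp add: add_fraction zero_localization)
    have "fraction R S (\<ominus> a) s \<oplus>\<^bsub>localization R S\<^esub> x = \<zero>\<^bsub>localization R S\<^esub>"
      unfolding a(1) zero_localization using a(2-4)
      by (simp add: add_fraction l_minus l_neg) (intro fraction_eqI; simp)
    then show "\<exists>y\<in>carrier (localization R S). y \<oplus>\<^bsub>localization R S\<^esub> x = \<zero>\<^bsub>localization R S\<^esub>"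
      using a by (intro bexI[of _ "fraction R S (\<ominus> a) s"]) auto
  qed (simp add: zero_localization)
  show "comm_monoid (localization R S)"
  proof (rule comm_monoidI)
    fix x y z
    assume x: "x \<in> carrier (localization R S)" and y: "y \<in> carrier (localization R S)"
      and z: "z \<in> carrier (localization R S)"
    obtain a s where a: "x = fraction R S a s" "a \<in> carrier R" "s \<in> S" "s \<in> carrier R"
      using x by (rule localization_cases)
    obtain b t where b: "y = fraction R S b t" "b \<in> carrier R" "t \<in> S" "t \<in> carrier R"
      using y by (rule localization_cases)
    obtain c q where c: "z = fraction R S c q" "c \<in> carrier R" "q \<in> S" "q \<in> carrier R"
      using z by (rule localization_cases)
    show "x \<otimes>\<^bsub>localization R S\<^esub> y \<in> carrier (localization R S)"
      using a b by (simp add: mult_fraction)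
    show "(x \<otimes>\<^bsub>localization R S\<^esub> y) \<otimes>\<^bsub>localization R S\<^esub> z =
        x \<otimes>\<^bsub>localization R S\<^esub> (y \<otimes>\<^bsub>localization R S\<^esub> z)"
      using a b c by (simp add: mult_fraction m_assoc)
    show "\<one>\<^bsub>localization R S\<^esub> \<otimes>\<^bsub>localization R S\<^esub> x = x"
      using a by (simp add: mult_fraction one_localization)
    show "x \<otimes>\<^bsub>localization R S\<^esub> y = y \<otimes>\<^bsub>localization R S\<^esub> x"
      using a b by (simp add: mult_fraction m_comm)
  qed (simp add: one_localization)
  fix x y z
  assume x: "x \<in> carrier (localization R S)" and y: "y \<in> carrier (localization R S)"
    and z: "z \<in> carrier (localization R S)"
  obtain a s where a: "x = fraction R S a s" "a \<in> carrier R" "s \<in> S" "s \<in> carrier R"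
    using x by (rule localization_cases)
  obtain b t where b: "y = fraction R S b t" "b \<in> carrier R" "t \<in> S" "t \<in> carrier R"
    using y by (rule localization_cases)
  obtain c q where c: "z = fraction R S c q" "c \<in> carrier R" "q \<in> S" "q \<in> carrier R"
    using z by (rule localization_cases)
  have "(a \<otimes> t \<oplus> b \<otimes> s) \<otimes> c \<otimes> (s \<otimes> q \<otimes> (t \<otimes> q)) =
      (a \<otimes> c \<otimes> (t \<otimes> q) \<oplus> b \<otimes> c \<otimes> (s \<otimes> q)) \<otimes> (s \<otimes> t \<otimes> q)"
    using a(2,4) b(2,4) c(2,4) by (simp add: m_ac a_ac l_distr r_distr)
  then show "(x \<oplus>\<^bsub>localization R S\<^esub> y) \<otimes>\<^bsub>localization R S\<^esub> z =
      x \<otimes>\<^bsub>localization R S\<^esub> z \<oplus>\<^bsub>localization R S\<^esub> y \<otimes>\<^bsub>localization R S\<^esub> z"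
    using a b c by (simp add: mult_fraction add_fraction) (intro fraction_eqI; simp)
qed

lemma ideal_fractions:
  assumes "ideal J R"
  shows "ideal {fraction R S a s | a s. a \<in> J \<and> s \<in> S} (localization R S)"
proof -
  interpret J: ideal J R by fact
  interpret L: cring "localization R S" by (rule cring_localization)
  let ?N = "{fraction R S a s | a s. a \<in> J \<and> s \<in> S}"
  have N_mult: "x \<otimes>\<^bsub>localization R S\<^esub> y \<in> ?N"
    if "x \<in> carrier (localization R S)" "y \<in> ?N" for x y
  proof -
    from that obtain a s b t where *: "a \<in> carrier R" "s \<in> S" "x = fraction R S a s"
      "b \<in> J" "t \<in> S" "y = fraction R S b t"
      unfolding carrier_localization by blast
    then have "x \<otimes>\<^bsub>localization R S\<^esub> y = fraction R S (a \<otimes> b) (s \<otimes> t)"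
      by (simp add: mult_fraction J.Icarr)
    moreover have "a \<otimes> b \<in> J" "s \<otimes> t \<in> S"
      using * by (simp_all add: J.I_l_closed)
    ultimately show ?thesis
      by blast
  qed
  have N_carr: "?N \<subseteq> carrier (localization R S)"
    by (auto simp: J.Icarr)
  show ?thesis
  proof (rule idealI[OF L.ring_axioms])
    show "subgroup ?N (add_monoid (localization R S))"
    proof (rule L.add.subgroupI)
      show "?N \<subseteq> carrier (localization R S)" by (rule N_carr)
      show "?N \<noteq> {}" using J.zero_closed S_one by blast
      fix x assume x: "x \<in> ?N"
      have "\<ominus>\<^bsub>localization R S\<^esub> x =
          (\<ominus>\<^bsub>localization R S\<^esub> \<one>\<^bsub>localization R S\<^esub>) \<otimes>\<^bsub>localization R S\<^esub> x"
        using x N_carr by (simp add: L.l_minus subset_iff)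
      then show "\<ominus>\<^bsub>localization R S\<^esub> x \<in> ?N"
        using N_mult[OF _ x] by simp
      fix y assume "y \<in> ?N"
      with x obtain a s b t where *: "a \<in> J" "s \<in> S" "x = fraction R S a s"
        "b \<in> J" "t \<in> S" "y = fraction R S b t" by blast
      then have "x \<oplus>\<^bsub>localization R S\<^esub> y = fraction R S (a \<otimes> t \<oplus> b \<otimes> s) (s \<otimes> t)"
        by (simp add: add_fraction J.Icarr)
      moreover have "a \<otimes> t \<oplus> b \<otimes> s \<in> J" "s \<otimes> t \<in> S"
        using * by (simp_all add: J.I_r_closed S_carrier)
      ultimately show "x \<oplus>\<^bsub>localization R S\<^esub> y \<in> ?N"
        by blast
    qed
    fix y x assume "y \<in> ?N" "x \<in> carrier (localization R S)"
    then have "x \<otimes>\<^bsub>localization R S\<^esub> y \<in> ?N"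
      and "x \<otimes>\<^bsub>localization R S\<^esub> y = y \<otimes>\<^bsub>localization R S\<^esub> x"
      using N_mult[of x y] N_carr L.m_comm[of x y] by blast+
    then show "x \<otimes>\<^bsub>localization R S\<^esub> y \<in> ?N" "y \<otimes>\<^bsub>localization R S\<^esub> x \<in> ?N"
      by argo+
  qed
qed

text \<open>The fractions with numerator in \<open>J\<close> form the ideal generated by the image of \<open>J\<close>, so
  \<open>r / 1\<close> lies in it iff some \<open>s \<in> S\<close> multiplies \<open>r\<close> into \<open>J\<close>. This removes the ring of fractions
  from all later arguments.\<close>

lemma fraction_in_genideal_iff:
  assumes "ideal J R" and r: "r \<in> carrier R"
  shows "fraction R S r \<one> \<in> genideal (localization R S) ((\<lambda>a. fraction R S a \<one>) ` J) \<longleftrightarrow>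
    (\<exists>s\<in>S. s \<otimes> r \<in> J)"
proof
  interpret J: ideal J R by fact
  interpret L: cring "localization R S" by (rule cring_localization)
  let ?G = "genideal (localization R S) ((\<lambda>a. fraction R S a \<one>) ` J)"
  let ?N = "{fraction R S a s | a s. a \<in> J \<and> s \<in> S}"
  {
    assume "fraction R S r \<one> \<in> ?G"
    moreover have "?G \<subseteq> ?N"
      by (rule L.genideal_minimal[OF ideal_fractions[OF assms(1)]]) (use S_one in blast)
    ultimately obtain a s where as: "a \<in> J" "s \<in> S" "fraction R S r \<one> = fraction R S a s"
      by auto
    then obtain u where u: "u \<in> S" "u \<otimes> (r \<otimes> s) = u \<otimes> (a \<otimes> \<one>)"
      using r by (auto simp: fraction_eq_iff J.Icarr)
    have "(u \<otimes> s) \<otimes> r = u \<otimes> (r \<otimes> s)"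
      using u(1) as r by (simp add: m_ac S_carrier)
    also have "\<dots> = u \<otimes> (a \<otimes> \<one>)"
      by (rule u(2))
    also have "\<dots> \<in> J"
      using as u(1) by (simp add: J.I_l_closed J.Icarr S_carrier)
    finally show "\<exists>s\<in>S. s \<otimes> r \<in> J"
      using u as by (intro bexI[of _ "u \<otimes> s"]) auto
  }
  {
    assume "\<exists>s\<in>S. s \<otimes> r \<in> J"
    then obtain s where s: "s \<in> S" "s \<otimes> r \<in> J" by blast
    have carr: "(\<lambda>a. fraction R S a \<one>) ` J \<subseteq> carrier (localization R S)"
      by (auto simp: J.Icarr)
    interpret G: ideal ?G "localization R S"
      by (rule L.genideal_ideal[OF carr])
    have "fraction R S (s \<otimes> r) \<one> \<in> ?G"
      using L.genideal_self[OF carr] s by auto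
    then have "fraction R S \<one> s \<otimes>\<^bsub>localization R S\<^esub> fraction R S (s \<otimes> r) \<one> \<in> ?G"
      using s by (intro G.I_l_closed) auto
    also have "fraction R S \<one> s \<otimes>\<^bsub>localization R S\<^esub> fraction R S (s \<otimes> r) \<one> = fraction R S r \<one>"
      using s r by (simp add: mult_fraction S_carrier) (intro fraction_eqI; simp add: m_ac S_carrier)
    finally show "fraction R S r \<one> \<in> ?G" .
  }
qed

end

lemma (in primeideal) cring_submonoid_compl: "cring_submonoid R (carrier R - I)"
proof (intro cring_submonoid.intro submonoid.intro)
  show "cring R" by (rule is_cring)
  show "\<one> \<in> carrier R - I" using I_notcarr one_imp_carrier by auto
qed (use I_prime in auto)

lemma mem_local_contraction_iff:
  assumes "primeideal P R" "ideal J R"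
  shows "r \<in> local_contraction R P J \<longleftrightarrow>
    r \<in> carrier R \<and> (\<exists>s\<in>carrier R - P. s \<otimes>\<^bsub>R\<^esub> r \<in> J)"
proof -
  interpret cring_submonoid R "carrier R - P"
    by (rule primeideal.cring_submonoid_compl[OF assms(1)])
  show ?thesis
    unfolding local_contraction_def local_ring_at_def to_local_ring_def[abs_def]
    using fraction_in_genideal_iff[OF assms(2)] by auto
qed

section \<open>Homogeneous components\<close>

lemma (in abelian_group) finsum_in_subgroup:
  assumes "additive_subgroup H G" "\<And>i. i \<in> F \<Longrightarrow> f i \<in> H"
  shows "(\<Oplus>i\<in>F. f i) \<in> H"
  using assms(2)
proof (induction F rule: infinite_finite_induct)
  case (insert x F)
  interpret H: additive_subgroup H G by fact
  have "f \<in> F \<rightarrow> carrier G" "f x \<in> carrier G"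
    using insert.prems H.a_subset by auto
  then show ?case
    using insert by simp
qed (simp_all add: additive_subgroup.zero_closed[OF assms(1)])

context graded_cring
begin

lemma piece_carrier: "a \<in> A i \<Longrightarrow> a \<in> carrier R"
  using additive_subgroup.a_subset[OF piece_subgroup] by blast

lemma component_decomposition:
  "r \<in> carrier R \<Longrightarrow> is_decomposition R A r (component R A r)"
  unfolding component_def by (rule theI'[OF decomposition])

lemma component_in_piece: "r \<in> carrier R \<Longrightarrow> component R A r i \<in> A i"
  using component_decomposition unfolding is_decomposition_def by blast

lemma component_closed [simp]: "r \<in> carrier R \<Longrightarrow> component R A r i \<in> carrier R"
  using component_in_piece piece_carrier by blast

definition support :: "'a \<Rightarrow> nat set" where
  "support r = {i. component R A r i \<noteq> \<zero>}"

lemma finite_support: "r \<in> carrier R \<Longrightarrow> finite (support r)"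
  using component_decomposition unfolding is_decomposition_def support_def by blast

lemma sum_components: "r \<in> carrier R \<Longrightarrow> (\<Oplus>i\<in>support r. component R A r i) = r"
  using component_decomposition unfolding is_decomposition_def support_def by metis

lemma component_eqI:
  assumes "\<And>i. c i \<in> A i" "finite F" "\<And>i. i \<notin> F \<Longrightarrow> c i = \<zero>" "r = (\<Oplus>i\<in>F. c i)"
  shows "component R A r = c"
proof -
  have carr: "c \<in> F \<rightarrow> carrier R"
    using assms(1) piece_carrier by blast
  have "{i. c i \<noteq> \<zero>} \<subseteq> F"
    using assms(3) by blast
  then have fin: "finite {i. c i \<noteq> \<zero>}"
    using assms(2) finite_subset by blast
  have "(\<Oplus>i\<in>{i. c i \<noteq> \<zero>}. c i) = (\<Oplus>i\<in>F. c i)"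
    by (rule add.finprod_mono_neutral_cong_left) (use assms carr in auto)
  then have dec: "is_decomposition R A r c"
    using assms fin unfolding is_decomposition_def by simp
  have "r \<in> carrier R"
    using carr assms(4) by simp
  from decomposition[OF this] dec show ?thesis
    unfolding component_def by (intro the1_equality)
qed

lemma component_zero [simp]: "component R A \<zero> i = \<zero>"
proof -
  have "component R A \<zero> = (\<lambda>_. \<zero>)"
    by (rule component_eqI[where F = "{}"])
       (auto simp: additive_subgroup.zero_closed[OF piece_subgroup])
  then show ?thesis by simp
qed

lemma component_piece: "a \<in> A i \<Longrightarrow> component R A a j = (if j = i then a else \<zero>)"
proof -
  assume a: "a \<in> A i"
  have "component R A a = (\<lambda>j. if j = i then a else \<zero>)"
    by (rule component_eqI[where F = "{i}"])
       (use a piece_carrier[OF a] in \<open>auto simp: additive_subgroup.zero_closed[OF piece_subgroup]\<close>)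
  then show ?thesis by simp
qed

lemma component_add:
  assumes "r \<in> carrier R" "s \<in> carrier R"
  shows "component R A (r \<oplus> s) i = component R A r i \<oplus> component R A s i"
proof -
  let ?F = "support r \<union> support s"
  have fin: "finite ?F"
    using assms finite_support by blast
  have ext: "(\<Oplus>i\<in>?F. component R A x i) = x" if "x \<in> carrier R" "support x \<subseteq> ?F" for x
  proof -
    have "(\<Oplus>i\<in>support x. component R A x i) = (\<Oplus>i\<in>?F. component R A x i)"
      by (rule add.finprod_mono_neutral_cong_left) (use that fin in \<open>auto simp: support_def\<close>)
    then show ?thesis
      using sum_components[OF that(1)] by simp
  qed
  have "component R A (r \<oplus> s) = (\<lambda>i. component R A r i \<oplus> component R A s i)"
  proof (rule component_eqI[OF _ fin])
    show "component R A r i \<oplus> component R A s i \<in> A i" for i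
      using assms by (intro additive_subgroup.a_closed[OF piece_subgroup] component_in_piece)
    show "component R A r i \<oplus> component R A s i = \<zero>" if "i \<notin> ?F" for i
      using that by (simp add: support_def)
    have "(\<Oplus>i\<in>?F. component R A r i \<oplus> component R A s i) =
        (\<Oplus>i\<in>?F. component R A r i) \<oplus> (\<Oplus>i\<in>?F. component R A s i)"
      using assms by (intro finsum_addf) auto
    then show "r \<oplus> s = (\<Oplus>i\<in>?F. component R A r i \<oplus> component R A s i)"
      using ext assms by simp
  qed
  then show ?thesis by simp
qed

lemma component_a_inv:
  assumes "r \<in> carrier R"
  shows "component R A (\<ominus> r) i = \<ominus> component R A r i"
proof -
  have "component R A (\<ominus> r) i \<oplus> component R A r i = \<zero>"
    using component_add[of "\<ominus> r" r i] assms by (simp add: l_neg)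
  then show ?thesis
    using assms by (intro minus_equality[symmetric]) auto
qed

lemma homogeneous_induct [consumes 1, case_names zero add]:
  assumes "r \<in> carrier R" and "P \<zero>"
    and "\<And>i a s. a \<in> A i \<Longrightarrow> s \<in> carrier R \<Longrightarrow> P s \<Longrightarrow> P (a \<oplus> s)"
  shows "P r"
proof -
  have "P (\<Oplus>i\<in>F. component R A r i)" if "finite F" for F
    using that
  proof induction
    case empty
    then show ?case using assms(2) by simp
  next
    case (insert i F)
    have *: "component R A r \<in> F \<rightarrow> carrier R"
      using assms(1) by simp
    have "P (component R A r i \<oplus> (\<Oplus>i\<in>F. component R A r i))"
      using * insert.IH by (intro assms(3)[OF component_in_piece[OF assms(1), of i]]) simp_all
    then show ?case
      using * insert.hyps assms(1) by simp
  qed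
  from this[OF finite_support[OF assms(1)]] show ?thesis
    using sum_components[OF assms(1)] by simp
qed

lemma component_piece_mult:
  assumes "r \<in> carrier R" "a \<in> A i"
  shows "component R A (a \<otimes> r) k = (if i \<le> k then a \<otimes> component R A r (k - i) else \<zero>)"
  using assms(1)
proof (induction r rule: homogeneous_induct)
  case zero
  then show ?case using piece_carrier[OF assms(2)] by simp
next
  case (add j b s)
  note c = piece_carrier[OF assms(2)] piece_carrier[OF add(1)] add(2)
  have "component R A (a \<otimes> (b \<oplus> s)) k = component R A (a \<otimes> b) k \<oplus> component R A (a \<otimes> s) k"
    using c by (simp add: r_distr component_add)
  also have "component R A (a \<otimes> b) k = (if k = i + j then a \<otimes> b else \<zero>)"
    by (rule component_piece[OF piece_mult[OF assms(2) add(1)]])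
  also have "\<dots> = (if i \<le> k then a \<otimes> component R A b (k - i) else \<zero>)"
    using c component_piece[OF add(1), of "k - i"] by auto
  finally show ?case
    using c add.IH by (simp add: component_add r_distr)
qed

lemma component_mult:
  assumes "r \<in> carrier R" "s \<in> carrier R"
  shows "component R A (r \<otimes> s) k = (\<Oplus>i\<in>{..k}. component R A r i \<otimes> component R A s (k - i))"
  using assms(1)
proof (induction r rule: homogeneous_induct)
  case zero
  then show ?case using assms(2) by simp
next
  case (add j a r)
  note c = piece_carrier[OF add(1)] add(2) assms(2)
  let ?f = "\<lambda>i. a \<otimes> component R A s (k - i)"
  have "(\<Oplus>i\<in>{..k}. component R A a i \<otimes> component R A s (k - i)) =
      (\<Oplus>i\<in>{..k}. if j = i then ?f i else \<zero>)"
    by (rule finsum_cong') (use c component_piece[OF add(1)] in auto)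
  also have "\<dots> = (if j \<le> k then ?f j else \<zero>)"
  proof (cases "j \<le> k")
    case True
    then show ?thesis
      using c by (subst finsum_singleton) auto
  next
    case False
    then have "(\<Oplus>i\<in>{..k}. if j = i then ?f i else \<zero>) = (\<Oplus>i\<in>{..k}. \<zero>)"
      by (intro finsum_cong') auto
    then show ?thesis using False by simp
  qed
  also have "\<dots> = component R A (a \<otimes> s) k"
    using component_piece_mult[OF assms(2) add(1)] by simp
  finally have a: "component R A (a \<otimes> s) k =
    (\<Oplus>i\<in>{..k}. component R A a i \<otimes> component R A s (k - i))" ..
  have "component R A ((a \<oplus> r) \<otimes> s) k = component R A (a \<otimes> s) k \<oplus> component R A (r \<otimes> s) k"
    using c by (simp add: l_distr component_add)
  also have "\<dots> = (\<Oplus>i\<in>{..k}. component R A a i \<otimes> component R A s (k - i) \<oplus>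
      component R A r i \<otimes> component R A s (k - i))"
    unfolding a add.IH using c by (intro finsum_addf[symmetric]) auto
  also have "\<dots> = (\<Oplus>i\<in>{..k}. component R A (a \<oplus> r) i \<otimes> component R A s (k - i))"
    by (rule finsum_cong') (use c in \<open>auto simp: component_add l_distr\<close>)
  finally show ?case .
qed

lemma component_mult_lowest:
  assumes "r \<in> carrier R" "s \<in> carrier R"
    and r: "\<And>i. i < e \<Longrightarrow> component R A r i = \<zero>" and s: "\<And>i. i < d \<Longrightarrow> component R A s i = \<zero>"
  shows "component R A (r \<otimes> s) (e + d) = component R A r e \<otimes> component R A s d"
proof -
  let ?f = "\<lambda>i. component R A r i \<otimes> component R A s (e + d - i)"
  have "?f i = \<zero>" if "i \<le> e + d" "i \<noteq> e" for i
  proof (cases "i < e")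
    case True
    then show ?thesis using r assms(2) by simp
  next
    case False
    then have "e + d - i < d" using that by linarith
    then show ?thesis using s assms(1) by simp
  qed
  then have "(\<Oplus>i\<in>{..e + d}. ?f i) = (\<Oplus>i\<in>{..e + d}. if e = i then ?f i else \<zero>)"
    using assms(1,2) by (intro finsum_cong') auto
  also have "\<dots> = ?f e"
    using assms(1,2) by (intro finsum_singleton) auto
  finally show ?thesis
    using component_mult[OF assms(1,2)] by simp
qed

definition component_stable :: "'a set \<Rightarrow> bool" where
  "component_stable K \<longleftrightarrow> (\<forall>r\<in>K. \<forall>i. component R A r i \<in> K)"

lemma component_stableD: "component_stable K \<Longrightarrow> r \<in> K \<Longrightarrow> component R A r i \<in> K"
  by (auto simp: component_stable_def)

text \<open>The elements whose components all lie in \<open>I\<close> form an ideal that contains the homogeneous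
  generators.\<close>

lemma homogeneous_ideal_component_stable:
  assumes "homogeneous_ideal R A I"
  shows "component_stable I"
proof -
  obtain H where H: "H \<subseteq> (\<Union>i. A i)" "I = Idl H" and "ideal I R"
    using assms unfolding homogeneous_ideal_def by blast
  interpret I: ideal I R by fact
  have HI: "H \<subseteq> I"
    unfolding H(2) using H(1) piece_carrier by (intro genideal_self) blast
  let ?N = "{r \<in> carrier R. \<forall>i. component R A r i \<in> I}"
  have N_mult: "x \<otimes> r \<in> ?N" if "r \<in> ?N" "x \<in> carrier R" for r x
    using that
    by (auto simp: component_mult I.I_l_closed intro!: finsum_in_subgroup I.additive_subgroup_axioms)
  have "ideal ?N R"
  proof (rule idealI[OF ring_axioms])
    show "subgroup ?N (add_monoid R)"
    proof (rule add.subgroupI)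
      show "?N \<noteq> {}" using I.zero_closed by (auto intro!: exI[of _ \<zero>])
    qed (auto simp: component_a_inv component_add)
  next
    fix r x assume *: "r \<in> ?N" "x \<in> carrier R"
    then show "x \<otimes> r \<in> ?N" by (rule N_mult)
    then show "r \<otimes> x \<in> ?N" using * m_comm by simp
  qed
  moreover have "H \<subseteq> ?N"
  proof
    fix h assume h: "h \<in> H"
    then obtain i where i: "h \<in> A i" using H(1) by blast
    show "h \<in> ?N"
      using h HI component_piece[OF i] piece_carrier[OF i] by auto
  qed
  ultimately have "I \<subseteq> ?N"
    unfolding H(2) by (rule genideal_minimal)
  then show ?thesis
    by (auto simp: component_stable_def)
qed

lemma ideal_prod_component_stable:
  assumes "ideal I R" "ideal J R" "component_stable I" "component_stable J"
  shows "component_stable (I \<cdot> J)"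
  unfolding component_stable_def
proof (intro ballI allI)
  fix r k assume "r \<in> I \<cdot> J"
  interpret IJ: ideal "I \<cdot> J" R by (rule ideal_prod_is_ideal[OF assms(1,2)])
  from \<open>r \<in> I \<cdot> J\<close> show "component R A r k \<in> I \<cdot> J"
  proof (induction rule: ideal_prod.induct)
    case (prod i j)
    have c: "i \<in> carrier R" "j \<in> carrier R"
      using ideal.Icarr[OF assms(1) prod(1)] ideal.Icarr[OF assms(2) prod(2)] .
    show ?case
      unfolding component_mult[OF c]
      by (intro finsum_in_subgroup IJ.additive_subgroup_axioms ideal_prod.prod
          component_stableD assms(3,4) prod)
  next
    case (sum s1 s2)
    then show ?case
      using IJ.Icarr by (simp add: component_add ideal_prod.sum)
  qed
qed

lemma support_drop:
  assumes "r \<in> carrier R"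
  shows "support (r \<ominus> component R A r d) = support r - {d}"
  using assms component_piece[OF component_in_piece[OF assms, of d]]
  by (auto simp: support_def a_minus_def component_add component_a_inv r_neg)

lemma component_drop:
  assumes "r \<in> carrier R" "i \<noteq> d"
  shows "component R A (r \<ominus> component R A r d) i = component R A r i"
  using assms component_piece[OF component_in_piece[OF assms(1), of d]]
  by (auto simp: a_minus_def component_add component_a_inv)

lemma card_support_piece_mult:
  assumes "r \<in> carrier R" "a \<in> A i"
  shows "card (support (a \<otimes> r)) \<le> card (support r)"
proof -
  have "support (a \<otimes> r) \<subseteq> (\<lambda>d. i + d) ` support r"
  proof
    fix k assume "k \<in> support (a \<otimes> r)"
    then have "i \<le> k" "component R A r (k - i) \<noteq> \<zero>"
      using component_piece_mult[OF assms, of k] piece_carrier[OF assms(2)]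
      by (auto simp: support_def split: if_splits)
    then show "k \<in> (\<lambda>d. i + d) ` support r"
      by (intro image_eqI[of _ _ "k - i"]) (auto simp: support_def)
  qed
  then show ?thesis
    using surj_card_le[OF finite_support[OF assms(1)]] by blast
qed

end

section \<open>Contractions of homogeneous ideals\<close>

context graded_cring
begin

text \<open>The contraction of \<open>K R\<^sub>P\<close> is homogeneous for every prime \<open>P\<close>, homogeneous or not. Write \<open>Q\<close> for
  the set of elements that some homogeneous \<open>t \<notin> P\<close> multiplies into \<open>K\<close>; it is visibly a homogeneous
  ideal, so it suffices that \<open>s r \<in> Q\<close> and \<open>s \<notin> P\<close> imply \<open>r \<in> Q\<close>. By induction on the number of
  components of \<open>r\<close>: if \<open>s r \<in> Q\<close>, the product \<open>s\<^sub>e r\<^sub>d\<close> of the lowest components lies in \<open>Q\<close>, hence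
  \<open>s (s\<^sub>e (r - r\<^sub>d)) \<in> Q\<close>, and the induction hypothesis gives \<open>s\<^sub>e (r - r\<^sub>d) \<in> Q\<close>, so \<open>s\<^sub>e r \<in> Q\<close>.
  Removing \<open>s\<^sub>e\<close> from \<open>s\<close> and repeating, \<open>s\<^sub>j r \<in> Q\<close> for all \<open>j\<close>, and some \<open>s\<^sub>j\<close> is not in \<open>P\<close>.\<close>

lemma contraction_component:
  assumes "primeideal P R" "ideal K R" "component_stable K"
    and r0: "r0 \<in> carrier R" and s0: "s0 \<in> carrier R" "s0 \<notin> P" "s0 \<otimes> r0 \<in> K"
  shows "\<exists>t\<in>carrier R - P. t \<otimes> component R A r0 i \<in> K"
proof -
  interpret P: primeideal P R by fact
  interpret K: ideal K R by fact
  define Q where "Q = {r \<in> carrier R. \<exists>j. \<exists>t\<in>A j - P. t \<otimes> r \<in> K}"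
  have Q_I: "r \<in> Q" if "r \<in> carrier R" "t \<in> A j" "t \<notin> P" "t \<otimes> r \<in> K" for r t j
    using that unfolding Q_def by blast
  have Q_E: thesis if "r \<in> Q"
    "\<And>j t. r \<in> carrier R \<Longrightarrow> t \<in> A j \<Longrightarrow> t \<in> carrier R \<Longrightarrow> t \<notin> P \<Longrightarrow> t \<otimes> r \<in> K \<Longrightarrow> thesis"
    for r thesis
    using that piece_carrier unfolding Q_def by blast
  have not_P: "s \<otimes> t \<notin> P" if "s \<in> carrier R" "t \<in> carrier R" "s \<notin> P" "t \<notin> P" for s t
    using that P.I_prime by blast
  have Q_carr: "r \<in> carrier R" if "r \<in> Q" for r
    using that unfolding Q_def by blast
  have Q_mult: "x \<otimes> r \<in> Q" if "r \<in> Q" "x \<in> carrier R" for x r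
  proof (rule Q_E[OF that(1)])
    fix j t assume t: "r \<in> carrier R" "t \<in> A j" "t \<in> carrier R" "t \<notin> P" "t \<otimes> r \<in> K"
    have "t \<otimes> (x \<otimes> r) = x \<otimes> (t \<otimes> r)"
      using t that(2) by (simp add: m_lcomm)
    also have "\<dots> \<in> K"
      using t(5) that(2) by (rule K.I_l_closed)
    finally show "x \<otimes> r \<in> Q"
      using t that(2) by (intro Q_I[OF _ t(2)]) auto
  qed
  have Q_inv: "\<ominus> r \<in> Q" if "r \<in> Q" for r
  proof -
    have "\<ominus> r = (\<ominus> \<one>) \<otimes> r"
      using Q_carr[OF that] by (simp add: l_minus)
    then show ?thesis using Q_mult[OF that, of "\<ominus> \<one>"] by simp
  qed
  have Q_add: "r \<oplus> r' \<in> Q" if "r \<in> Q" "r' \<in> Q" for r r'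
  proof (rule Q_E[OF that(1)], rule Q_E[OF that(2)])
    fix j t j' t' assume t: "r \<in> carrier R" "t \<in> A j" "t \<in> carrier R" "t \<notin> P" "t \<otimes> r \<in> K"
      and t': "r' \<in> carrier R" "t' \<in> A j'" "t' \<in> carrier R" "t' \<notin> P" "t' \<otimes> r' \<in> K"
    have "(t \<otimes> t') \<otimes> (r \<oplus> r') = t' \<otimes> (t \<otimes> r) \<oplus> t \<otimes> (t' \<otimes> r')"
      using t t' by (simp add: r_distr m_ac)
    also have "\<dots> \<in> K"
      by (rule K.a_closed[OF K.I_l_closed[OF t(5) t'(3)] K.I_l_closed[OF t'(5) t(3)]])
    finally show "r \<oplus> r' \<in> Q"
      using t t' not_P by (intro Q_I[OF _ piece_mult[OF t(2) t'(2)]]) auto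
  qed
  have Q_comp: "component R A r d \<in> Q" if "r \<in> Q" for r d
  proof (rule Q_E[OF that])
    fix j t assume t: "r \<in> carrier R" "t \<in> A j" "t \<in> carrier R" "t \<notin> P" "t \<otimes> r \<in> K"
    have "t \<otimes> component R A r d = component R A (t \<otimes> r) (j + d)"
      using component_piece_mult[OF t(1,2)] by simp
    also have "\<dots> \<in> K"
      by (rule component_stableD[OF assms(3) t(5)])
    finally show "component R A r d \<in> Q"
      using t by (intro Q_I[OF _ t(2)]) auto
  qed
  obtain j0 where j0: "component R A s0 j0 \<notin> P"
  proof (rule ccontr)
    assume "\<not> thesis"
    then have "(\<Oplus>j\<in>support s0. component R A s0 j) \<in> P"
      using that by (intro finsum_in_subgroup P.additive_subgroup_axioms) blast
    then show False
      using s0 sum_components by simp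
  qed
  note t0 = component_in_piece[OF s0(1), of j0] component_closed[OF s0(1), of j0] j0
  have Q_prime: "r \<in> Q" if "r \<in> carrier R" "component R A s0 j0 \<otimes> r \<in> Q" for r
  proof (rule Q_E[OF that(2)])
    fix j t assume t: "t \<in> A j" "t \<in> carrier R" "t \<notin> P" "t \<otimes> (component R A s0 j0 \<otimes> r) \<in> K"
    then have "(t \<otimes> component R A s0 j0) \<otimes> r \<in> K"
      using t0 that(1) by (simp add: m_assoc)
    then show "r \<in> Q"
      using t0 t that(1) not_P by (intro Q_I[OF _ piece_mult[OF t(1) t0(1)]]) auto
  qed
  have Q_zero: "\<zero> \<in> Q"
    using t0 by (intro Q_I[OF _ t0(1)]) auto
  have saturated: "r \<in> Q" if "r \<in> carrier R" "s0 \<otimes> r \<in> Q" for r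
    using that
  proof (induction "card (support r)" arbitrary: r rule: less_induct)
    case less
    show ?case
    proof (cases "support r = {}")
      case True
      then show ?thesis
        using sum_components[OF less.prems(1)] Q_zero by simp
    next
      case False
      define d where "d = (LEAST d. d \<in> support r)"
      have d: "d \<in> support r"
        unfolding d_def using False by (auto intro: LeastI)
      have d_min: "component R A r i = \<zero>" if "i < d" for i
        using not_less_Least[of i "\<lambda>d. d \<in> support r"] that unfolding d_def support_def by simp
      define r' where "r' = r \<ominus> component R A r d"
      have r': "r' \<in> carrier R" "r = r' \<oplus> component R A r d"
        using less.prems(1) unfolding r'_def by (simp_all add: a_minus_def a_assoc l_neg)
      have card_r': "card (support r') < card (support r)"
        unfolding r'_def support_drop[OF less.prems(1)]
        using d finite_support[OF less.prems(1)] by (intro psubset_card_mono) auto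
      have "component R A s i \<otimes> r \<in> Q" if "s \<in> carrier R" "s \<otimes> r \<in> Q" for s i
        using that
      proof (induction "card (support s)" arbitrary: s rule: less_induct)
        case (less s)
        note s = less.prems(1)
        show ?case
        proof (cases "support s = {}")
          case True
          then have "component R A s i = \<zero>" by (auto simp: support_def)
          then show ?thesis
            using Q_zero \<open>r \<in> carrier R\<close> by simp
        next
          case False
          define e where "e = (LEAST e. e \<in> support s)"
          have e: "e \<in> support s"
            unfolding e_def using False by (auto intro: LeastI)
          have e_min: "component R A s i = \<zero>" if "i < e" for i
            using not_less_Least[of i "\<lambda>e. e \<in> support s"] that unfolding e_def support_def by simp
          let ?a = "component R A s e" and ?b = "component R A r d"
          have a: "?a \<in> A e" "?a \<in> carrier R" and b: "?b \<in> carrier R"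
            using s \<open>r \<in> carrier R\<close> component_in_piece by auto
          have low: "?a \<otimes> ?b \<in> Q"
            using Q_comp[OF less.prems(2), of "e + d"]
              component_mult_lowest[OF s \<open>r \<in> carrier R\<close> e_min d_min] by simp
          have "s0 \<otimes> (?a \<otimes> r') = ?a \<otimes> (s0 \<otimes> r) \<oplus> \<ominus> (s0 \<otimes> (?a \<otimes> ?b))"
            unfolding r'_def using a b s0(1) \<open>r \<in> carrier R\<close>
            by (simp add: a_minus_def r_distr r_minus m_lcomm)
          also have "\<dots> \<in> Q"
            by (intro Q_add Q_inv Q_mult low a s0(1) \<open>s0 \<otimes> r \<in> Q\<close>)
          finally have "s0 \<otimes> (?a \<otimes> r') \<in> Q" .
          moreover have "card (support (?a \<otimes> r')) < card (support r)"
            using card_support_piece_mult[OF r'(1) a(1)] card_r' by linarith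
          ultimately have "?a \<otimes> r' \<in> Q"
            using \<open>\<And>x. card (support x) < card (support r) \<Longrightarrow> x \<in> carrier R \<Longrightarrow>
              s0 \<otimes> x \<in> Q \<Longrightarrow> x \<in> Q\<close> a r' by simp
          moreover have "?a \<otimes> r = ?a \<otimes> r' \<oplus> ?a \<otimes> ?b"
            using a b r' by (metis r_distr)
          ultimately have ar: "?a \<otimes> r \<in> Q"
            using low Q_add by simp
          show ?thesis
          proof (cases "i = e")
            case True
            then show ?thesis using ar by simp
          next
            case False
            have "(s \<ominus> ?a) \<otimes> r = s \<otimes> r \<oplus> \<ominus> (?a \<otimes> r)"
              using s a \<open>r \<in> carrier R\<close> by (simp add: a_minus_def l_distr l_minus)
            then have "(s \<ominus> ?a) \<otimes> r \<in> Q"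
              using less.prems(2) ar Q_add Q_inv by simp
            moreover have "card (support (s \<ominus> ?a)) < card (support s)"
              unfolding support_drop[OF s]
              using e finite_support[OF s] by (intro psubset_card_mono) auto
            ultimately have "component R A (s \<ominus> ?a) i \<otimes> r \<in> Q"
              using less.hyps[of "s \<ominus> ?a"] s a by simp
            then show ?thesis
              using component_drop[OF s False] by simp
          qed
        qed
      qed
      from this[OF s0(1) less.prems(2)] show ?thesis
        by (rule Q_prime[OF less.prems(1)])
    qed
  qed
  have "s0 \<otimes> r0 \<in> Q"
    by (rule Q_I[OF _ t0(1,3) K.I_l_closed[OF s0(3) t0(2)]]) (use s0(1) r0 in simp)
  then have "component R A r0 i \<in> Q"
    by (rule Q_comp[OF saturated[OF r0]])
  then show ?thesis
  proof (rule Q_E)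
    fix t assume "t \<in> carrier R" "t \<notin> P" "t \<otimes> component R A r0 i \<in> K"
    then show ?thesis by (intro bexI[of _ t] DiffI)
  qed
qed

end

section \<open>Symbolic powers\<close>

context cring
begin

lemma ideal_pow_ideal: "ideal I R \<Longrightarrow> ideal (I [^]\<^bsub>ideals_set R\<^esub> (m::nat)) R"
  using monoid.nat_pow_closed[OF comm_monoid.axioms(1)[OF ideals_set_is_comm_monoid], of I m]
  by (simp add: ideals_set_def)

lemma ideal_pow_add:
  assumes "ideal I R"
  shows "(I [^]\<^bsub>ideals_set R\<^esub> (a::nat)) \<cdot> (I [^]\<^bsub>ideals_set R\<^esub> (b::nat)) =
    I [^]\<^bsub>ideals_set R\<^esub> (a + b)"
proof -
  have "I \<in> carrier (ideals_set R)"
    using assms by (simp add: ideals_set_def)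
  from monoid.nat_pow_mult[OF comm_monoid.axioms(1)[OF ideals_set_is_comm_monoid] this, of a b]
  show ?thesis by (simp add: ideals_set_def)
qed

lemma ideal_pow_antimono:
  assumes "ideal I R" "a \<le> b"
  shows "I [^]\<^bsub>ideals_set R\<^esub> (b::nat) \<subseteq> I [^]\<^bsub>ideals_set R\<^esub> (a::nat)"
proof -
  obtain c where "b = a + c" using assms(2) le_Suc_ex by blast
  then show ?thesis
    using ideal_pow_add[OF assms(1), of a c]
      ideal_prod_inter[OF ideal_pow_ideal[OF assms(1)] ideal_pow_ideal[OF assms(1)], of a c]
    by auto
qed

lemma mem_symbolic_power_iff:
  assumes "ideal I R"
  shows "r \<in> symbolic_power R I m \<longleftrightarrow> r \<in> carrier R \<and>
    (\<forall>P\<in>associated_primes R I. \<exists>s\<in>carrier R - P. s \<otimes> r \<in> I [^]\<^bsub>ideals_set R\<^esub> m)"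
proof -
  have "r \<in> local_contraction R P (I [^]\<^bsub>ideals_set R\<^esub> m) \<longleftrightarrow>
      r \<in> carrier R \<and> (\<exists>s\<in>carrier R - P. s \<otimes> r \<in> I [^]\<^bsub>ideals_set R\<^esub> m)"
    if "P \<in> associated_primes R I" for P
    using that by (intro mem_local_contraction_iff ideal_pow_ideal assms)
      (simp add: associated_primes_def)
  then show ?thesis
    unfolding symbolic_power_def by auto
qed

lemma symbolic_power_carrier: "r \<in> symbolic_power R I m \<Longrightarrow> r \<in> carrier R"
  by (simp add: symbolic_power_def)

lemma associated_primesD: "P \<in> associated_primes R I \<Longrightarrow> primeideal P R"
  by (simp add: associated_primes_def)

lemma symbolic_power_antimono:
  assumes "ideal I R" "a \<le> b"
  shows "symbolic_power R I b \<subseteq> symbolic_power R I a"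
  using ideal_pow_antimono[OF assms] unfolding mem_symbolic_power_iff[OF assms(1)] subset_iff
  by meson

lemma symbolic_power_mult:
  assumes I: "ideal I R" and x: "x \<in> symbolic_power R I a" and y: "y \<in> symbolic_power R I b"
  shows "x \<otimes> y \<in> symbolic_power R I (a + b)"
  unfolding mem_symbolic_power_iff[OF I]
proof (intro conjI ballI)
  note c = symbolic_power_carrier[OF x] symbolic_power_carrier[OF y]
  then show "x \<otimes> y \<in> carrier R" by simp
  fix P assume P: "P \<in> associated_primes R I"
  interpret P: primeideal P R by (rule associated_primesD[OF P])
  obtain s t where s: "s \<in> carrier R" "s \<notin> P" "s \<otimes> x \<in> I [^]\<^bsub>ideals_set R\<^esub> a"
    and t: "t \<in> carrier R" "t \<notin> P" "t \<otimes> y \<in> I [^]\<^bsub>ideals_set R\<^esub> b"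
    using x y P unfolding mem_symbolic_power_iff[OF I] by blast
  have "(s \<otimes> t) \<otimes> (x \<otimes> y) = (s \<otimes> x) \<otimes> (t \<otimes> y)"
    using s(1) t(1) c by (simp add: m_ac)
  also have "\<dots> \<in> I [^]\<^bsub>ideals_set R\<^esub> (a + b)"
    unfolding ideal_pow_add[OF I, symmetric] by (rule ideal_prod.prod[OF s(3) t(3)])
  finally show "\<exists>u\<in>carrier R - P. u \<otimes> (x \<otimes> y) \<in> I [^]\<^bsub>ideals_set R\<^esub> (a + b)"
    using s t P.I_prime by (intro bexI[of _ "s \<otimes> t"]) auto
qed

lemma zero_in_symbolic_power:
  assumes "ideal I R"
  shows "\<zero> \<in> symbolic_power R I m"
  unfolding mem_symbolic_power_iff[OF assms]
proof (intro conjI ballI)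
  fix P assume "P \<in> associated_primes R I"
  then interpret P: primeideal P R by (rule associated_primesD)
  have "\<one> \<notin> P" using P.I_notcarr P.one_imp_carrier by auto
  moreover have "\<one> \<otimes> \<zero> \<in> I [^]\<^bsub>ideals_set R\<^esub> m"
    using additive_subgroup.zero_closed[OF ideal.axioms(1)[OF ideal_pow_ideal[OF assms]]] by simp
  ultimately show "\<exists>s\<in>carrier R - P. s \<otimes> \<zero> \<in> I [^]\<^bsub>ideals_set R\<^esub> m"
    by blast
qed simp

lemma symbolic_power_nat_pow:
  assumes "ideal I R" "x \<in> symbolic_power R I a"
  shows "x [^] Suc q \<in> symbolic_power R I (a * Suc q)"
proof (induction q)
  case 0
  then show ?case
    using assms(2) symbolic_power_carrier[OF assms(2)] by simp
next
  case (Suc q)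
  have "x [^] Suc q \<otimes> x \<in> symbolic_power R I (a * Suc q + a)"
    by (rule symbolic_power_mult[OF assms(1) Suc assms(2)])
  also have "a * Suc q + a = a * Suc (Suc q)" by simp
  finally show ?case by simp
qed

end

context graded_cring
begin

lemma symbolic_power_component_stable:
  assumes "homogeneous_ideal R A I"
  shows "component_stable (symbolic_power R I m)"
proof -
  have I: "ideal I R" using assms by (simp add: homogeneous_ideal_def)
  have pow: "component_stable (I [^]\<^bsub>ideals_set R\<^esub> m)" for m :: nat
  proof (induction m)
    case 0
    then show ?case by (simp add: ideals_set_def component_stable_def)
  next
    case (Suc m)
    then have "component_stable ((I [^]\<^bsub>ideals_set R\<^esub> m) \<cdot> I)"
      using homogeneous_ideal_component_stable[OF assms]
      by (intro ideal_prod_component_stable[OF ideal_pow_ideal[OF I] I])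
    then show ?case
      by (simp add: ideals_set_def)
  qed
  show ?thesis
    unfolding component_stable_def mem_symbolic_power_iff[OF I]
  proof (intro ballI allI conjI)
    fix r i P assume r: "r \<in> symbolic_power R I m" and P: "P \<in> associated_primes R I"
    then obtain s where s: "s \<in> carrier R" "s \<notin> P" "s \<otimes> r \<in> I [^]\<^bsub>ideals_set R\<^esub> m"
      unfolding mem_symbolic_power_iff[OF I] by blast
    show "\<exists>s\<in>carrier R - P. s \<otimes> component R A r i \<in> I [^]\<^bsub>ideals_set R\<^esub> m"
      by (rule contraction_component[OF associated_primesD[OF P] ideal_pow_ideal[OF I] pow
            symbolic_power_carrier[OF r] s])
  qed (simp add: symbolic_power_carrier)
qed

section \<open>Initial degrees\<close>

lemma initial_degree_le:
  assumes "f \<in> J" "f \<in> A d" "f \<noteq> \<zero>"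
  shows "initial_degree R A J \<le> enat d"
proof -
  have "{i. component R A f i \<noteq> \<zero>} = {d}"
    using component_piece[OF assms(2)] assms(3) by auto
  then have "graded_degree R A f = d"
    by (simp add: graded_degree_def)
  then show ?thesis
    unfolding initial_degree_def using assms(1,3) by (intro INF_lower2[of f]) auto
qed

text \<open>An element of \<open>J\<close> of least degree need not be homogeneous, but its component of top degree is
  again in \<open>J\<close> and has the same degree.\<close>

lemma initial_degree_attained:
  assumes "component_stable J" "J \<subseteq> carrier R" "initial_degree R A J = enat d"
  obtains f where "f \<in> J" "f \<in> A d" "f \<noteq> \<zero>"
proof -
  let ?D = "(\<lambda>f. enat (graded_degree R A f)) ` (J - {\<zero>})"
  have inf: "Inf ?D = enat d"
    using assms(3) by (simp add: initial_degree_def)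
  then have "?D \<noteq> {}"
    by (auto simp: Inf_enat_def)
  then have "Inf ?D \<in> ?D"
    unfolding Inf_enat_def by (auto intro: LeastI)
  then obtain f where f: "f \<in> J" "f \<noteq> \<zero>" "graded_degree R A f = d"
    unfolding inf by auto
  have fc: "f \<in> carrier R"
    using f(1) assms(2) by blast
  have "support f \<noteq> {}"
    using f(2) sum_components[OF fc] by auto
  then have "d \<in> support f"
    using Max_in[OF finite_support[OF fc]] f(3) unfolding graded_degree_def support_def by simp
  then show thesis
    using that[of "component R A f d"] component_stableD[OF assms(1) f(1)] component_in_piece[OF fc]
    by (simp add: support_def)
qed

lemma piece_nat_pow: "f \<in> A d \<Longrightarrow> f [^] Suc q \<in> A (d * Suc q)"
proof (induction q)
  case 0
  then show ?case using piece_carrier[OF 0] by simp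
next
  case (Suc q)
  have "f [^] Suc q \<otimes> f \<in> A (d * Suc q + d)"
    by (rule piece_mult[OF Suc.IH[OF Suc.prems] Suc.prems])
  also have "d * Suc q + d = d * Suc (Suc q)" by simp
  finally show ?case by simp
qed

text \<open>The slope \<open>\<mu>\<close> is an extended real so that an infinite minimum needs no separate argument: as
  \<open>\<infinity> * 0 = 0\<close>, \<open>slope_ge \<infinity> i\<close> is zero for \<open>i > 0\<close>, while \<open>slope_ge \<infinity> 0\<close> is the whole ring.\<close>

definition slope_ge :: "ereal \<Rightarrow> nat \<Rightarrow> 'a set" where
  "slope_ge \<mu> i = {r \<in> carrier R. \<forall>d. component R A r d \<noteq> \<zero> \<longrightarrow> \<mu> * ereal (real i) \<le> ereal (real d)}"

lemma slope_ge_subgroup: "additive_subgroup (slope_ge \<mu> i) R"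
proof (rule additive_subgroupI, rule add.subgroupI)
  show "slope_ge \<mu> i \<noteq> {}"
    by (auto simp: slope_ge_def intro!: exI[of _ \<zero>])
  fix r assume r: "r \<in> slope_ge \<mu> i"
  then show "\<ominus> r \<in> slope_ge \<mu> i"
    by (auto simp: slope_ge_def component_a_inv)
  fix s assume s: "s \<in> slope_ge \<mu> i"
  have "component R A r d \<noteq> \<zero> \<or> component R A s d \<noteq> \<zero>" if "component R A (r \<oplus> s) d \<noteq> \<zero>" for d
    using that r s by (auto simp: slope_ge_def component_add)
  then show "r \<oplus> s \<in> slope_ge \<mu> i"
    using r s unfolding slope_ge_def by auto
qed (auto simp: slope_ge_def)

lemma slope_ge_mult:
  assumes "0 \<le> \<mu>" and r: "r \<in> slope_ge \<mu> i" and s: "s \<in> slope_ge \<mu> j"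
  shows "r \<otimes> s \<in> slope_ge \<mu> (i + j)"
proof -
  have c: "r \<in> carrier R" "s \<in> carrier R"
    using r s by (auto simp: slope_ge_def)
  have "\<mu> * ereal (real (i + j)) \<le> ereal (real d)" if nz: "component R A (r \<otimes> s) d \<noteq> \<zero>" for d
  proof -
    have "\<exists>k\<le>d. component R A r k \<otimes> component R A s (d - k) \<noteq> \<zero>"
    proof (rule ccontr)
      assume "\<not> ?thesis"
      then have "(\<Oplus>k\<in>{..d}. component R A r k \<otimes> component R A s (d - k)) = \<zero>"
        by (intro add.finprod_one_eqI) auto
      then show False
        using nz component_mult[OF c] by simp
    qed
    then obtain k where k: "k \<le> d" "component R A r k \<otimes> component R A s (d - k) \<noteq> \<zero>"
      by blast
    then have nz: "component R A r k \<noteq> \<zero>" "component R A s (d - k) \<noteq> \<zero>"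
      using c by auto
    have "\<mu> * ereal (real (i + j)) = \<mu> * ereal (real i) + \<mu> * ereal (real j)"
      using assms(1) by (simp add: ereal_right_distrib flip: plus_ereal.simps(1))
    also have "\<dots> \<le> ereal (real k) + ereal (real (d - k))"
      using r s nz by (intro add_mono) (auto simp: slope_ge_def)
    also have "\<dots> = ereal (real d)"
      using k(1) by simp
    finally show ?thesis .
  qed
  then show ?thesis
    using c by (auto simp: slope_ge_def)
qed

text \<open>By homogeneity every component of an element of \<open>I\<^sup>(\<^sup>m\<^sup>)\<close> is itself an element of \<open>I\<^sup>(\<^sup>m\<^sup>)\<close>. A bound
  on the top degrees of all nonzero elements is therefore the same as a bound on the degrees of
  all their components. Only the second form is compatible with sums, where top components can
  cancel.\<close>

lemma waldschmidt_quotient_ge_iff: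
  assumes "homogeneous_ideal R A I" "1 \<le> m"
  shows "\<mu> \<le> waldschmidt_quotient R A I m \<longleftrightarrow> symbolic_power R I m \<subseteq> slope_ge \<mu> m"
proof -
  let ?J = "symbolic_power R I m"
  have stable: "component_stable ?J"
    by (rule symbolic_power_component_stable[OF assms(1)])
  have m: "ereal (real m) > 0" "ereal (real m) \<noteq> \<infinity>"
    using assms(2) by auto
  have iff: "\<mu> \<le> waldschmidt_quotient R A I m \<longleftrightarrow>
      \<mu> * ereal (real m) \<le> ereal_of_enat (initial_degree R A ?J)"
    unfolding waldschmidt_quotient_def using ereal_le_divide_pos[OF m] by (simp add: mult.commute)
  show ?thesis
    unfolding iff
  proof (intro iffI subsetI)
    fix r assume le: "\<mu> * ereal (real m) \<le> ereal_of_enat (initial_degree R A ?J)" and r: "r \<in> ?J"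
    have "\<mu> * ereal (real m) \<le> ereal (real d)" if "component R A r d \<noteq> \<zero>" for d
    proof -
      have "initial_degree R A ?J \<le> enat d"
        using that component_stableD[OF stable r] component_in_piece[OF symbolic_power_carrier[OF r]]
        by (intro initial_degree_le[of "component R A r d"])
      then have "ereal_of_enat (initial_degree R A ?J) \<le> ereal_of_enat (enat d)"
        by (simp only: ereal_of_enat_le_iff)
      with le show ?thesis by simp
    qed
    then show "r \<in> slope_ge \<mu> m"
      using symbolic_power_carrier[OF r] by (auto simp: slope_ge_def)
  next
    assume sub: "?J \<subseteq> slope_ge \<mu> m"
    show "\<mu> * ereal (real m) \<le> ereal_of_enat (initial_degree R A ?J)"
    proof (cases "initial_degree R A ?J")
      case (enat d)
      obtain f where f: "f \<in> ?J" "f \<in> A d" "f \<noteq> \<zero>"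
        using initial_degree_attained[OF stable _ enat] symbolic_power_carrier by blast
      then have "component R A f d \<noteq> \<zero>" "f \<in> slope_ge \<mu> m"
        using sub component_piece[OF f(2)] by auto
      then show ?thesis
        unfolding enat slope_ge_def by simp
    qed simp
  qed
qed

section \<open>Bounds for the Waldschmidt quotients\<close>

text \<open>The polynomials with coefficients in \<open>slope_ge \<mu> i\<close> at \<open>t\<^sup>i\<close> form a subring of \<open>R[t]\<close> that contains
  the generators of the symbolic Rees algebra.\<close>

lemma waldschmidt_quotient_lower:
  assumes I: "homogeneous_ideal R A I" and gen: "symbolic_Rees_generated_upto R I n"
    and \<mu>: "0 \<le> \<mu>" "\<And>i. 1 \<le> i \<Longrightarrow> i \<le> n \<Longrightarrow> \<mu> \<le> waldschmidt_quotient R A I i"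
    and m: "1 \<le> m"
  shows "\<mu> \<le> waldschmidt_quotient R A I m"
proof -
  interpret UP: UP_cring R "UP R"
    by unfold_locales simp
  let ?H = "{up_ring.monom (UP R) a 0 | a. a \<in> carrier R} \<union>
    {up_ring.monom (UP R) a i | a i. 1 \<le> i \<and> i \<le> n \<and> a \<in> symbolic_power R I i}"
  have I': "ideal I R" using I by (simp add: homogeneous_ideal_def)
  have slope_zero: "\<zero> \<in> slope_ge \<mu> i" for i
    by (rule additive_subgroup.zero_closed[OF slope_ge_subgroup])
  have slope_0: "r \<in> slope_ge \<mu> 0" if "r \<in> carrier R" for r
    using that by (auto simp: slope_ge_def zero_ereal_def[symmetric])
  have slopes: "g \<in> carrier (UP R) \<and> (\<forall>i. up_ring.coeff (UP R) g i \<in> slope_ge \<mu> i)"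
    if "g \<in> generate_ring (UP R) ?H" for g
    using that
  proof (induction rule: generate_ring.induct)
    case one
    then show ?case using slope_zero slope_0 by simp
  next
    case (incl h)
    then consider a where "h = up_ring.monom (UP R) a 0" "a \<in> carrier R"
      | a i where "h = up_ring.monom (UP R) a i" "1 \<le> i" "i \<le> n" "a \<in> symbolic_power R I i"
      by blast
    then show ?case
    proof cases
      case 1
      then show ?thesis using slope_zero slope_0 by simp
    next
      case 2
      then have "a \<in> slope_ge \<mu> i"
        using \<mu>(2) waldschmidt_quotient_ge_iff[OF I] by blast
      then show ?thesis
        using 2 slope_zero symbolic_power_carrier[OF 2(4)] by simp
    qed
  next
    case (a_inv h)
    then show ?case
      using additive_subgroup.a_inv_closed[OF slope_ge_subgroup] by simp
  next
    case (eng_add h1 h2)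
    then show ?case
      using additive_subgroup.a_closed[OF slope_ge_subgroup] by simp
  next
    case (eng_mult h1 h2)
    have prod: "up_ring.coeff (UP R) h1 k \<otimes> up_ring.coeff (UP R) h2 (i - k) \<in> slope_ge \<mu> i"
      if "k \<in> {..i}" for k i
      using slope_ge_mult[OF \<mu>(1), of "up_ring.coeff (UP R) h1 k" k "up_ring.coeff (UP R) h2 (i - k)" "i - k"]
        eng_mult.IH that by simp
    have "(\<Oplus>k\<in>{..i}. up_ring.coeff (UP R) h1 k \<otimes> up_ring.coeff (UP R) h2 (i - k))
        \<in> slope_ge \<mu> i" for i
      by (rule finsum_in_subgroup[OF slope_ge_subgroup prod])
    then show ?case
      using eng_mult.IH by simp
  qed
  have "f \<in> slope_ge \<mu> m" if f: "f \<in> symbolic_power R I m" for f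
  proof -
    have fc: "f \<in> carrier R" by (rule symbolic_power_carrier[OF f])
    then have "up_ring.monom (UP R) f m \<in> symbolic_Rees_algebra R I"
      using f zero_in_symbolic_power[OF I'] by (simp add: symbolic_Rees_algebra_def)
    then have "up_ring.monom (UP R) f m \<in> generate_ring (UP R) ?H"
      using gen by (simp add: symbolic_Rees_generated_upto_def)
    then have "up_ring.coeff (UP R) (up_ring.monom (UP R) f m) m \<in> slope_ge \<mu> m"
      using slopes by blast
    then show ?thesis using fc by simp
  qed
  then show ?thesis
    using waldschmidt_quotient_ge_iff[OF I m] by blast
qed

text \<open>The exponent of \<open>f\<close> is \<open>m / k\<close> rounded down plus one, so that \<open>f\<^sup>q\<^sup>+\<^sup>1\<close> lies deep enough to be in \<open>I\<^sup>(\<^sup>m\<^sup>)\<close>; the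
  rounding costs at most one extra factor \<open>f\<close>, hence the error term \<open>d / m\<close>.\<close>

lemma waldschmidt_quotient_upper:
  assumes I: "ideal I R" "component_stable (symbolic_power R I k)" and red: "reduced_ring R"
    and k: "1 \<le> k" and d: "initial_degree R A (symbolic_power R I k) = enat d" and m: "1 \<le> m"
  shows "waldschmidt_quotient R A I m \<le> ereal (real d / real k + real d / real m)"
proof -
  obtain f where f: "f \<in> symbolic_power R I k" "f \<in> A d" "f \<noteq> \<zero>"
    using initial_degree_attained[OF I(2) _ d] symbolic_power_carrier by blast
  let ?q = "m div k"
  have "m \<le> k * Suc ?q"
    using dividend_less_times_div[of k m] k by simp
  then have "f [^] Suc ?q \<in> symbolic_power R I m"
    using symbolic_power_nat_pow[OF I(1) f(1)] symbolic_power_antimono[OF I(1)] by blast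
  moreover have "f [^] Suc ?q \<noteq> \<zero>"
    using red f(3) symbolic_power_carrier[OF f(1)] unfolding reduced_ring_def by blast
  ultimately have "initial_degree R A (symbolic_power R I m) \<le> enat (d * Suc ?q)"
    using piece_nat_pow[OF f(2)] by (intro initial_degree_le)
  then have "ereal_of_enat (initial_degree R A (symbolic_power R I m)) \<le>
      ereal_of_enat (enat (d * Suc ?q))"
    by (simp only: ereal_of_enat_le_iff)
  then have "waldschmidt_quotient R A I m \<le> ereal (real (d * Suc ?q)) / ereal (real m)"
    unfolding waldschmidt_quotient_def using m by (intro ereal_divide_right_mono) auto
  also have "\<dots> = ereal (real d * (real ?q + 1) / real m)"
    using m by (simp add: algebra_simps)
  also have "\<dots> \<le> ereal (real d / real k + real d / real m)"
  proof -
    have "real ?q \<le> real m / real k"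
      by (rule of_nat_div_le_of_nat)
    then have "real d * real ?q / real m \<le> real d * (real m / real k) / real m"
      by (intro divide_right_mono mult_left_mono) auto
    also have "\<dots> = real d / real k"
      using m by simp
    finally show ?thesis
      by (simp add: distrib_left add_divide_distrib)
  qed
  finally show ?thesis .
qed

end

theorem theorem3p6:
  fixes R :: "('a, 'b) ring_scheme"
    and A :: "nat \<Rightarrow> 'a set"
    and I :: "'a set"
    and n :: nat
  assumes "graded_cring R A"
    and "noetherian_ring R"
    and "reduced_ring R"
    and "homogeneous_ideal R A I"
    and "1 \<le> n"
    and "symbolic_Rees_generated_upto R I n"
  shows "convergent (waldschmidt_quotient R A I) \<and>
         waldschmidt_constant R A I = (MIN m\<in>{1..n}. waldschmidt_quotient R A I m)"
proof -
  interpret graded_cring R A by fact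
  let ?w = "waldschmidt_quotient R A I"
  define \<mu> where "\<mu> = (MIN m\<in>{1..n}. ?w m)"
  have I: "ideal I R"
    using assms(4) by (simp add: homogeneous_ideal_def)
  have "\<mu> \<in> ?w ` {1..n}"
    unfolding \<mu>_def using assms(5) by (intro Min_in) auto
  then obtain k where k: "1 \<le> k" "?w k = \<mu>"
    by auto
  have "0 \<le> \<mu>"
    using k(1) unfolding k(2)[symmetric] waldschmidt_quotient_def
    by (cases "initial_degree R A (symbolic_power R I k)") auto
  moreover have "\<mu> \<le> ?w i" if "1 \<le> i" "i \<le> n" for i
    unfolding \<mu>_def using that by (intro Min_le) auto
  ultimately have lower: "\<mu> \<le> ?w m" if "1 \<le> m" for m
    using that by (rule waldschmidt_quotient_lower[OF assms(4,6)])
  have "?w \<longlonglongrightarrow> \<mu>"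
  proof (cases "initial_degree R A (symbolic_power R I k)")
    case (enat d)
    have \<mu>: "\<mu> = ereal (real d / real k)"
      using k enat by (auto simp: waldschmidt_quotient_def)
    have "(\<lambda>m. real d / real k + real d / real m) \<longlonglongrightarrow> real d / real k + 0"
      by (intro tendsto_add tendsto_const lim_const_over_n)
    then have upper_lim: "(\<lambda>m. ereal (real d / real k + real d / real m)) \<longlonglongrightarrow> \<mu>"
      unfolding \<mu> by (intro tendsto_ereal) simp
    show ?thesis
    proof (rule tendsto_sandwich[OF _ _ tendsto_const upper_lim])
      show "\<forall>\<^sub>F m in sequentially. \<mu> \<le> ?w m"
        using eventually_ge_at_top[of 1] by eventually_elim (rule lower)
      show "\<forall>\<^sub>F m in sequentially. ?w m \<le> ereal (real d / real k + real d / real m)"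
        using eventually_ge_at_top[of 1]
        by eventually_elim
          (rule waldschmidt_quotient_upper[OF I symbolic_power_component_stable[OF assms(4)]
              assms(3) k(1) enat])
    qed
  next
    case infinity
    then have "\<mu> = \<infinity>"
      using k by (auto simp: waldschmidt_quotient_def)
    then have "?w m = \<mu>" if "1 \<le> m" for m
      using lower[OF that] by auto
    then have "\<forall>\<^sub>F m in sequentially. ?w m = \<mu>"
      by (rule eventually_sequentiallyI)
    then show ?thesis
      by (rule tendsto_eventually)
  qed
  then show ?thesis
    unfolding waldschmidt_constant_def \<mu>_def[symmetric] by (auto simp: convergentI limI)
qed

end
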